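(* Let $k$ be a field and $r\in\mathbb{Q}\cap\,]0,+\infty[$. Then there exists a finite-dimensional regular evolution $k$-algebra $A$ such that $\mathrm{Aut}(A)$ is finite and $$r=\frac{|\mathrm{Aut}(A)|}{\dim_k(A)},$$ where $\mathrm{Aut}(A)$ is the group of $k$-algebra automorphisms of $A$.
   Context: A $k$-algebra is a $k$-vector space $A$ with a $k$-bilinear product $A\times A\to A$ (not assumed associative or unital). An algebra homomorphism is a $k$-linear map commuting with the products; automorphisms are the invertible ones from $A$ to $A$. A $k$-algebra $A$ is an evolution algebra if it has a vector space basis $\{b_i\mid i\in I\}$ (called a natural basis) such that $b_ib_j=0$ whenever $i\neq j$. It is a regular evolution algebra if moreover $A^2=A$, where $A^2$ is the linear span of all products of two elements of $A$. *)

theory Defs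
  imports Complex_Main "HOL-Library.Function_Algebras" "HOL-Algebra.Coset" "HOL-Algebra.Bij"
begin

text \<open>
  An algebra is given by a subspace \<open>A\<close> of an ambient \<open>k\<close>-vector space (a whole type) together with
  a product on \<open>A\<close>. Values of the product outside \<open>A\<close> are irrelevant. Neither
  associativity nor a unit is assumed.
\<close>

locale nonassoc_algebra = vector_space scale
  for scale :: "'k::field \<Rightarrow> 'v::ab_group_add \<Rightarrow> 'v" (infixr "*s" 75) +
  fixes A :: "'v set" and mul :: "'v \<Rightarrow> 'v \<Rightarrow> 'v" (infixl "\<star>" 70)
  assumes subspace_A: "subspace A"
    and mul_closed: "\<lbrakk>x \<in> A; y \<in> A\<rbrakk> \<Longrightarrow> x \<star> y \<in> A"
    and mul_add_left: "\<lbrakk>x \<in> A; y \<in> A; z \<in> A\<rbrakk> \<Longrightarrow> (x + y) \<star> z = x \<star> z + y \<star> z"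
    and mul_add_right: "\<lbrakk>x \<in> A; y \<in> A; z \<in> A\<rbrakk> \<Longrightarrow> x \<star> (y + z) = x \<star> y + x \<star> z"
    and mul_scale_left: "\<lbrakk>x \<in> A; y \<in> A\<rbrakk> \<Longrightarrow> (c *s x) \<star> y = c *s (x \<star> y)"
    and mul_scale_right: "\<lbrakk>x \<in> A; y \<in> A\<rbrakk> \<Longrightarrow> x \<star> (c *s y) = c *s (x \<star> y)"
begin

definition fin_dim :: bool where
  "fin_dim \<longleftrightarrow> (\<exists>B. finite B \<and> span B = A)"

definition natural_basis :: "'v set \<Rightarrow> bool" where
  "natural_basis B \<longleftrightarrow>
     independent B \<and> span B = A \<and> (\<forall>b\<in>B. \<forall>c\<in>B. b \<noteq> c \<longrightarrow> b \<star> c = 0)"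

definition algebra_endo :: "('v \<Rightarrow> 'v) \<Rightarrow> bool" where
  "algebra_endo f \<longleftrightarrow>
     f \<in> A \<rightarrow> A \<and>
     (\<forall>x\<in>A. \<forall>y\<in>A. f (x + y) = f x + f y) \<and>
     (\<forall>c. \<forall>x\<in>A. f (c *s x) = c *s f x) \<and>
     (\<forall>x\<in>A. \<forall>y\<in>A. f (x \<star> y) = f x \<star> f y)"

text \<open>
  The elements of \<open>Bij A\<close> are the bijections of \<open>A\<close> that are \<open>undefined\<close> outside \<open>A\<close>, so each
  automorphism is represented by exactly one function. The group operation is composition.
\<close>

definition Aut :: "('v \<Rightarrow> 'v) monoid" where
  "Aut = BijGroup A \<lparr>carrier := {f \<in> Bij A. algebra_endo f}\<rparr>"

lemma subgroup_Aut: "subgroup (carrier Aut) (BijGroup A)"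
proof (rule group.subgroupI[OF group_BijGroup])
  have cA: "carrier Aut = {f \<in> Bij A. algebra_endo f}"
    by (simp add: Aut_def)
  have addA: "x + y \<in> A" if "x \<in> A" "y \<in> A" for x y
    using subspace_add[OF subspace_A that] .
  have scaleA: "c *s x \<in> A" if "x \<in> A" for c x
    using subspace_scale[OF subspace_A that] .
  show "carrier Aut \<subseteq> carrier (BijGroup A)"
    by (auto simp: cA BijGroup_def)
  have "(\<lambda>x\<in>A. x) \<in> carrier Aut"
    by (auto simp: cA id_Bij algebra_endo_def addA scaleA mul_closed)
  then show "carrier Aut \<noteq> {}" by blast
  fix f assume f: "f \<in> carrier Aut"
  then have fB: "f \<in> Bij A" and fe: "algebra_endo f"
    by (auto simp: cA)
  have bij: "bij_betw f A A" using fB by (simp add: Bij_def)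
  let ?g = "inv_into A f"
  have gA: "?g x \<in> A" and fg: "f (?g x) = x" if "x \<in> A" for x
    using bij that by (auto simp: bij_betw_def inv_into_into f_inv_into_f)
  have gf: "?g (f x) = x" if "x \<in> A" for x
    using bij that by (auto simp: bij_betw_def)
  have "?g (x + y) = ?g x + ?g y" if "x \<in> A" "y \<in> A" for x y
    using gf[OF addA[OF gA[OF that(1)] gA[OF that(2)]]] fe that gA fg
    by (simp add: algebra_endo_def)
  moreover have "?g (c *s x) = c *s ?g x" if "x \<in> A" for c x
    using gf[OF scaleA[OF gA[OF that]]] fe that gA fg by (simp add: algebra_endo_def)
  moreover have "?g (x \<star> y) = ?g x \<star> ?g y" if "x \<in> A" "y \<in> A" for x y
    using gf[OF mul_closed[OF gA[OF that(1)] gA[OF that(2)]]] fe that gA fg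
    by (simp add: algebra_endo_def)
  ultimately have "algebra_endo (\<lambda>x\<in>A. ?g x)"
    by (simp add: algebra_endo_def gA addA scaleA mul_closed)
  then show "inv\<^bsub>BijGroup A\<^esub> f \<in> carrier Aut"
    by (simp add: inv_BijGroup[OF fB] cA restrict_inv_into_Bij[OF fB])
  fix h assume h: "h \<in> carrier Aut"
  then have hB: "h \<in> Bij A" and he: "algebra_endo h"
    by (auto simp: cA)
  have "algebra_endo (compose A f h)"
    using fe he by (simp add: algebra_endo_def compose_def addA scaleA mul_closed Pi_iff)
  then show "f \<otimes>\<^bsub>BijGroup A\<^esub> h \<in> carrier Aut"
    using fB hB by (simp add: cA BijGroup_def compose_Bij)
qed

lemma group_Aut: "group Aut"
  using subgroup.subgroup_is_group[OF subgroup_Aut group_BijGroup]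
  by (simp add: Aut_def)

end

locale evolution_algebra = nonassoc_algebra +
  assumes ex_natural_basis: "\<exists>B. natural_basis B"

locale regular_evolution_algebra = evolution_algebra +
  assumes span_products: "span {x \<star> y |x y. x \<in> A \<and> y \<in> A} = A"

end

theory Submission
  imports Defs "HOL-Combinatorics.Permutations"
begin

text \<open>
  Let \<open>a\<close> be a lower triangular \<open>n \<times> n\<close> matrix over \<open>k\<close> with ones on the diagonal, and let \<open>A\<close> be
  the evolution algebra with natural basis \<open>e i\<close>, \<open>i < n\<close>, in which the square of \<open>e i\<close> is row \<open>i\<close>
  of \<open>a\<close>. Such a matrix is invertible over every field, so \<open>A\<close> is regular. An automorphism maps the
  \<open>e i\<close> to nonzero vectors with zero mutual products. As the rows of \<open>a\<close> are independent, a zero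
  product means disjoint supports, and \<open>n\<close> disjoint nonempty subsets of an \<open>n\<close>-element set are
  singletons; hence \<open>e i\<close> goes to \<open>c i * e (\<sigma> i)\<close> for a permutation \<open>\<sigma>\<close> and nonzero scalars \<open>c i\<close>
  (\<open>Aut_monomial\<close>). Comparing squares gives \<open>a i j * c j = (c i)\<^sup>2 * a (\<sigma> i) (\<sigma> j)\<close>, and the ones on
  the diagonal force \<open>c i = 1\<close>. Thus the automorphisms of \<open>A\<close> correspond to the permutations that
  preserve \<open>a\<close> (\<open>order_Aut\<close>), whatever the field is.

  It remains to find a matrix with the right number of symmetries. For \<open>1 \<le> m \<le> n\<close> let the square of
  \<open>e i\<close> be \<open>e i\<close> if \<open>i < m\<close> and \<open>e 0 + \<dots> + e i\<close> if \<open>i \<ge> m\<close>. The number of nonzero entries in a row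
  tells the rows \<open>i \<ge> m\<close> apart from each other and from the first \<open>m\<close>, while the first \<open>m\<close> indices
  can be permuted at will. So there are \<open>m!\<close> automorphisms in dimension \<open>n\<close>
  (\<open>matrix_symmetries_staircase\<close>). For \<open>r = p / q\<close> with positive integers \<open>p\<close> and \<open>q\<close>, the choice
  \<open>m = p + 1\<close> and \<open>n = q (p + 1) (p - 1)!\<close> satisfies \<open>m \<le> n\<close> and \<open>m! / n = p / q\<close>.
\<close>

section \<open>Coordinate spaces\<close>

definition coord_scale :: "'k::field \<Rightarrow> (nat \<Rightarrow> 'k) \<Rightarrow> (nat \<Rightarrow> 'k)" where
  "coord_scale c x = (\<lambda>i. c * x i)"

text \<open>
  Vectors of length \<open>n\<close> are sequences that vanish from index \<open>n\<close> on, so that a single type contains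
  the coordinate spaces of all dimensions.
\<close>
definition coord_space :: "nat \<Rightarrow> (nat \<Rightarrow> 'k::field) set" where
  "coord_space n = {x. \<forall>i\<ge>n. x i = 0}"

definition unit_vec :: "nat \<Rightarrow> (nat \<Rightarrow> 'k::field)" where
  "unit_vec i = (\<lambda>j. if j = i then 1 else 0)"

interpretation coord: vector_space coord_scale
  by unfold_locales (auto simp: coord_scale_def fun_eq_iff algebra_simps)

lemma sum_fun_apply: "(\<Sum>i\<in>S. g i) j = (\<Sum>i\<in>S. g i (j::nat))"
  by (induction S rule: infinite_finite_induct) auto

lemma subspace_coord_space: "coord.subspace (coord_space n)"
  by (auto simp: coord.subspace_def coord_space_def coord_scale_def)

lemma unit_vec_in_coord_space: "i < n \<Longrightarrow> unit_vec i \<in> (coord_space n :: (nat \<Rightarrow> 'k::field) set)"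
  by (auto simp: coord_space_def unit_vec_def)

lemma unit_vec_inject: "unit_vec i = (unit_vec j :: nat \<Rightarrow> 'k::field) \<longleftrightarrow> i = j"
  by (auto simp: unit_vec_def fun_eq_iff split: if_splits)

lemma coord_expansion:
  assumes "x \<in> coord_space n"
  shows "x = (\<Sum>i<n. coord_scale (x i) (unit_vec i))"
proof
  fix j
  have "(\<Sum>i<n. coord_scale (x i) (unit_vec i) j) = (\<Sum>i<n. if i = j then x i else 0)"
    by (rule sum.cong) (auto simp: coord_scale_def unit_vec_def)
  also have "\<dots> = x j"
    using assms by (auto simp: coord_space_def)
  finally show "x j = (\<Sum>i<n. coord_scale (x i) (unit_vec i)) j"
    by (simp add: sum_fun_apply)
qed

lemma span_unit_vecs: "coord.span (unit_vec ` {..<n}) = (coord_space n :: (nat \<Rightarrow> 'k::field) set)"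
proof
  show "coord.span (unit_vec ` {..<n}) \<subseteq> (coord_space n :: (nat \<Rightarrow> 'k) set)"
    by (rule coord.span_minimal[OF _ subspace_coord_space])
      (auto simp: unit_vec_in_coord_space)
  show "(coord_space n :: (nat \<Rightarrow> 'k) set) \<subseteq> coord.span (unit_vec ` {..<n})"
  proof
    fix x :: "nat \<Rightarrow> 'k" assume "x \<in> coord_space n"
    then have "x = (\<Sum>i<n. coord_scale (x i) (unit_vec i))"
      by (rule coord_expansion)
    also have "\<dots> \<in> coord.span (unit_vec ` {..<n})"
      by (intro coord.span_sum coord.span_scale coord.span_base) auto
    finally show "x \<in> coord.span (unit_vec ` {..<n})" .
  qed
qed

lemma independent_unit_vecs:
  "coord.independent (unit_vec ` {..<n} :: (nat \<Rightarrow> 'k::field) set)"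
proof (rule coord.independent_if_scalars_zero)
  show "finite (unit_vec ` {..<n} :: (nat \<Rightarrow> 'k) set)" by simp
  fix u :: "(nat \<Rightarrow> 'k) \<Rightarrow> 'k" and x :: "nat \<Rightarrow> 'k"
  assume 0: "(\<Sum>y\<in>unit_vec ` {..<n}. coord_scale (u y) y) = 0" and "x \<in> unit_vec ` {..<n}"
  then obtain j where j: "x = unit_vec j" "j < n" by auto
  have "0 = (\<Sum>i<n. coord_scale (u (unit_vec i)) (unit_vec i)) j"
    using 0 by (subst (asm) sum.reindex) (auto simp: inj_on_def unit_vec_inject)
  also have "\<dots> = (\<Sum>i<n. if i = j then u (unit_vec i) else 0)"
    unfolding sum_fun_apply
    by (rule sum.cong) (auto simp: coord_scale_def unit_vec_def)
  also have "\<dots> = u x" using j by simp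
  finally show "u x = 0" by simp
qed

lemma dim_coord_space: "coord.dim (coord_space n :: (nat \<Rightarrow> 'k::field) set) = n"
proof -
  have "coord.dim (coord_space n :: (nat \<Rightarrow> 'k) set) = card (unit_vec ` {..<n} :: (nat \<Rightarrow> 'k) set)"
    by (rule coord.dim_eq_card)
      (simp_all add: independent_unit_vecs span_unit_vecs coord.span_eq_iff[THEN iffD2]
        subspace_coord_space)
  also have "\<dots> = n"
    by (subst card_image) (auto simp: inj_on_def unit_vec_inject)
  finally show ?thesis .
qed

section \<open>Evolution algebras of unitriangular matrices\<close>

definition evolution_mul ::
    "nat \<Rightarrow> (nat \<Rightarrow> nat \<Rightarrow> 'k) \<Rightarrow> (nat \<Rightarrow> 'k) \<Rightarrow> (nat \<Rightarrow> 'k) \<Rightarrow> (nat \<Rightarrow> 'k::field)" where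
  "evolution_mul n a x y = (\<lambda>j. \<Sum>i<n. x i * y i * a i j)"

definition matrix_symmetries :: "nat \<Rightarrow> (nat \<Rightarrow> nat \<Rightarrow> 'k) \<Rightarrow> (nat \<Rightarrow> nat) set" where
  "matrix_symmetries n a = {\<sigma>. \<sigma> permutes {..<n} \<and> (\<forall>i<n. \<forall>j<n. a (\<sigma> i) (\<sigma> j) = a i j)}"

lemma evolution_mul_unit_vec:
  "evolution_mul n a (coord_scale c (unit_vec i)) (coord_scale d (unit_vec j)) =
    (if i = j \<and> i < n then (\<lambda>l. c * d * a i l) else 0)"
proof
  fix l
  have "evolution_mul n a (coord_scale c (unit_vec i)) (coord_scale d (unit_vec j)) l =
      (\<Sum>s<n. if s = i then (if i = j then c * d * a i l else 0) else 0)"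
    unfolding evolution_mul_def by (rule sum.cong) (auto simp: coord_scale_def unit_vec_def)
  then show "evolution_mul n a (coord_scale c (unit_vec i)) (coord_scale d (unit_vec j)) l =
    (if i = j \<and> i < n then (\<lambda>l. c * d * a i l) else 0) l"
    by auto
qed

lemma evolution_mul_unit_vec':
  "evolution_mul n a (unit_vec i) (unit_vec j) = (if i = j \<and> i < n then a i else 0)"
  using evolution_mul_unit_vec[of n a 1 i 1 j] by (simp add: coord_scale_def)

locale lower_unitriangular =
  fixes n :: nat and a :: "nat \<Rightarrow> nat \<Rightarrow> 'k::field"
  assumes diagonal: "i < n \<Longrightarrow> a i i = 1"
    and above_diagonal: "i < n \<Longrightarrow> i < j \<Longrightarrow> a i j = 0"
begin

lemmas unit_vec_in_algebra = unit_vec_in_coord_space[where 'k='k]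

lemma row_in_coord_space: "i < n \<Longrightarrow> a i \<in> coord_space n"
  using above_diagonal by (simp add: coord_space_def)

sublocale nonassoc_algebra coord_scale "coord_space n" "evolution_mul n a"
proof
  show "coord.subspace (coord_space n :: (nat \<Rightarrow> 'k) set)"
    by (rule subspace_coord_space)
  show "evolution_mul n a x y \<in> coord_space n" for x y
    using row_in_coord_space by (auto simp: coord_space_def evolution_mul_def)
qed (auto simp: evolution_mul_def coord_scale_def fun_eq_iff algebra_simps
      sum.distrib sum_distrib_left)

lemma natural_basis_unit_vecs: "natural_basis (unit_vec ` {..<n})"
  by (auto simp: natural_basis_def independent_unit_vecs span_unit_vecs evolution_mul_unit_vec')

text \<open>
  The square of \<open>e i\<close> differs from \<open>e i\<close> by a combination of the \<open>e j\<close> with \<open>j < i\<close>, so all basis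
  vectors are combinations of squares by induction on \<open>i\<close>.
\<close>
lemma unit_vec_in_span_products:
  assumes "i < n"
  shows "unit_vec i \<in>
    coord.span {evolution_mul n a x y |x y. x \<in> coord_space n \<and> y \<in> coord_space n}"
    (is "_ \<in> coord.span ?P")
  using assms
proof (induction i rule: less_induct)
  case (less i)
  have "a i \<in> coord_space (Suc i)"
    using above_diagonal[OF less.prems] by (simp add: coord_space_def)
  then have "a i = (\<Sum>j<Suc i. coord_scale (a i j) (unit_vec j))"
    by (rule coord_expansion)
  also have "\<dots> = (\<Sum>j<i. coord_scale (a i j) (unit_vec j)) + unit_vec i"
    by (simp add: diagonal less.prems)
  finally have "unit_vec i = a i - (\<Sum>j<i. coord_scale (a i j) (unit_vec j))"
    by (metis add_diff_cancel_left')
  also have "\<dots> \<in> coord.span ?P"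
  proof (rule coord.span_diff)
    have "a i = evolution_mul n a (unit_vec i) (unit_vec i)"
      using less.prems by (simp add: evolution_mul_unit_vec')
    then show "a i \<in> coord.span ?P"
      using unit_vec_in_algebra[OF less.prems]
      by (intro coord.span_base) blast
    show "(\<Sum>j<i. coord_scale (a i j) (unit_vec j)) \<in> coord.span ?P"
      using less by (intro coord.span_sum coord.span_scale) auto
  qed
  finally show ?case .
qed

sublocale regular_evolution_algebra coord_scale "coord_space n" "evolution_mul n a"
proof
  show "\<exists>B. natural_basis B"
    using natural_basis_unit_vecs by blast
  let ?P = "{evolution_mul n a x y |x y. x \<in> coord_space n \<and> y \<in> coord_space n}"
  show "coord.span ?P = coord_space n"
  proof
    show "coord.span ?P \<subseteq> coord_space n"
      by (rule coord.span_minimal[OF _ subspace_coord_space]) (auto intro: mul_closed)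
    have "coord.span (unit_vec ` {..<n}) \<subseteq> coord.span ?P"
      by (rule coord.span_minimal) (auto simp: unit_vec_in_span_products)
    then show "coord_space n \<subseteq> coord.span ?P"
      by (simp add: span_unit_vecs)
  qed
qed

lemma fin_dim: "fin_dim"
  unfolding fin_dim_def using span_unit_vecs by blast

section \<open>Automorphisms are matrix symmetries\<close>

text \<open>
  Column \<open>l\<close> of \<open>a\<close> is zero in the rows above \<open>l\<close>. Once the coefficients with index greater than
  \<open>l\<close> are known to vanish, the equation for column \<open>l\<close> reads \<open>z l = 0\<close>; hence the downward
  induction.
\<close>
lemma rows_independent:
  assumes "\<And>j. j < n \<Longrightarrow> (\<Sum>i<n. z i * a i j) = 0" "l < n"
  shows "z l = 0"
  using assms(2)
proof (induction "n - l" arbitrary: l rule: less_induct)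
  case less
  have "z i * a i l = (if i = l then z l else 0)" if "i < n" for i
  proof (cases i l rule: linorder_cases)
    case less then show ?thesis using above_diagonal that by simp
  next
    case equal then show ?thesis using diagonal that by simp
  next
    case greater
    then have "z i = 0" using less.hyps[of i] that by simp
    then show ?thesis using greater by simp
  qed
  then have "(\<Sum>i<n. z i * a i l) = (\<Sum>i<n. if i = l then z l else 0)"
    by (intro sum.cong) auto
  then show ?case using assms(1)[OF less.prems] less.prems by simp
qed

text \<open>
  The product of \<open>x\<close> and \<open>y\<close> is the combination of the rows of \<open>a\<close> with coefficients \<open>x l * y l\<close>,
  and the rows are independent.
\<close>
lemma mul_eq_0_imp_disjoint_supports:
  assumes "evolution_mul n a x y = 0" "l < n"
  shows "x l = 0 \<or> y l = 0"
proof -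
  have "(\<Sum>i<n. (x i * y i) * a i j) = 0" for j
    using fun_cong[OF assms(1), of j] by (simp add: evolution_mul_def)
  then have "x l * y l = 0" using rows_independent[of "\<lambda>i. x i * y i", OF _ assms(2)] by blast
  then show ?thesis by simp
qed

lemma Aut_iff: "f \<in> carrier Aut \<longleftrightarrow> f \<in> Bij (coord_space n) \<and> algebra_endo f"
  by (simp add: Aut_def)

lemma
  assumes "algebra_endo f" "x \<in> coord_space n"
  shows endo_add: "y \<in> coord_space n \<Longrightarrow> f (x + y) = f x + f y"
    and endo_scale: "f (coord_scale c x) = coord_scale c (f x)"
    and endo_mul: "y \<in> coord_space n \<Longrightarrow> f (evolution_mul n a x y) = evolution_mul n a (f x) (f y)"
  using assms unfolding algebra_endo_def by blast+

lemma algebra_endo_expansion: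
  assumes f: "algebra_endo f" and x: "x \<in> coord_space n"
  shows "f x = (\<Sum>i<n. coord_scale (x i) (f (unit_vec i)))"
proof -
  have f0: "f 0 = 0"
  proof -
    have "(0::nat \<Rightarrow> 'k) \<in> coord_space n" by (simp add: coord_space_def)
    then have "f (0 + 0) = f 0 + f 0" using endo_add[OF f] by blast
    then show ?thesis by simp
  qed
  have "f (\<Sum>i<m. coord_scale (x i) (unit_vec i)) = (\<Sum>i<m. coord_scale (x i) (f (unit_vec i)))"
    if "m \<le> n" for m
    using that
  proof (induction m)
    case 0
    then show ?case using f0 by (simp add: zero_fun_def)
  next
    case (Suc m)
    have m: "unit_vec m \<in> (coord_space n :: (nat \<Rightarrow> 'k) set)"
      using Suc.prems by (simp add: unit_vec_in_algebra)
    have "(\<Sum>i<m. coord_scale (x i) (unit_vec i)) \<in> coord_space n"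
      using Suc.prems
      by (intro coord.subspace_sum[OF subspace_coord_space]
          coord.subspace_scale[OF subspace_coord_space] unit_vec_in_algebra) auto
    moreover have "coord_scale (x m) (unit_vec m) \<in> coord_space n"
      by (intro coord.subspace_scale[OF subspace_coord_space] m)
    ultimately show ?case
      using Suc by (simp only: sum.lessThan_Suc endo_add[OF f] endo_scale[OF f m] Suc_leD)
  qed
  from this[of n] show ?thesis using coord_expansion[OF x] by simp
qed

text \<open>
  The supports of the images of the basis vectors are \<open>n\<close> nonempty, pairwise disjoint subsets of
  \<open>{..<n}\<close>. Choosing an element in each of them gives an injective, hence bijective, self-map of
  \<open>{..<n}\<close>, which leaves no room for a second element.
\<close>
lemma Aut_monomial:
  assumes "f \<in> carrier Aut"
  obtains \<sigma> c where "\<sigma> permutes {..<n}"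
    and "\<And>i. i < n \<Longrightarrow> f (unit_vec i) = coord_scale (c i) (unit_vec (\<sigma> i))"
    and "\<And>i. i < n \<Longrightarrow> c i \<noteq> 0"
proof -
  have bij: "bij_betw f (coord_space n) (coord_space n)" and f: "algebra_endo f"
    using assms by (auto simp: Aut_iff Bij_def)
  have zero: "(0::nat \<Rightarrow> 'k) \<in> coord_space n" by (simp add: coord_space_def)
  have f0: "f 0 = 0"
    using algebra_endo_expansion[OF f zero] by (simp add: coord_scale_def fun_eq_iff sum_fun_apply)
  have mem: "f (unit_vec i) \<in> coord_space n" if "i < n" for i
    using unit_vec_in_algebra[OF that] bij by (auto simp: bij_betw_def)
  have "\<exists>l<n. f (unit_vec i) l \<noteq> 0" if "i < n" for i
  proof (rule ccontr)
    assume "\<not> ?thesis"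
    then have "f (unit_vec i) l = 0" for l
      using mem[OF that] by (cases "l < n") (auto simp: coord_space_def)
    then have "f (unit_vec i) = f 0"
      unfolding f0 by (simp add: fun_eq_iff)
    then have "unit_vec i = (0::nat \<Rightarrow> 'k)"
      using bij unit_vec_in_algebra[OF that] zero by (auto simp: bij_betw_def inj_on_def)
    from fun_cong[OF this, of i] show False by (simp add: unit_vec_def)
  qed
  then obtain s where s: "\<And>i. i < n \<Longrightarrow> s i < n" "\<And>i. i < n \<Longrightarrow> f (unit_vec i) (s i) \<noteq> 0"
    by metis
  have disjoint: "i = j"
    if "i < n" "j < n" "l < n" "f (unit_vec i) l \<noteq> 0" "f (unit_vec j) l \<noteq> 0" for i j l
  proof (rule ccontr)
    assume "i \<noteq> j"
    then have "f (evolution_mul n a (unit_vec i) (unit_vec j)) = 0"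
      by (simp add: evolution_mul_unit_vec' f0)
    then have "evolution_mul n a (f (unit_vec i)) (f (unit_vec j)) = 0"
      using that unit_vec_in_algebra by (simp only: endo_mul[OF f])
    from mul_eq_0_imp_disjoint_supports[OF this that(3)] show False using that by simp
  qed
  have inj: "inj_on s {..<n}"
    using s disjoint by (auto simp: inj_on_def) metis
  have onto: "s ` {..<n} = {..<n}"
    using s inj by (intro endo_inj_surj) auto
  have support: "l = s i" if "i < n" "l < n" "f (unit_vec i) l \<noteq> 0" for i l
  proof -
    have "l \<in> s ` {..<n}" using onto that by simp
    then obtain j where "j < n" "l = s j" by blast
    then show ?thesis using disjoint[of i j l] s that by simp
  qed
  define \<sigma> where "\<sigma> i = (if i < n then s i else i)" for i
  have "\<sigma> permutes {..<n}"
  proof (rule bij_imp_permutes)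
    have "bij_betw s {..<n} {..<n}" using inj onto by (simp add: bij_betw_def)
    then show "bij_betw \<sigma> {..<n} {..<n}" by (subst bij_betw_cong[where g = s]) (auto simp: \<sigma>_def)
  qed (auto simp: \<sigma>_def)
  moreover have "f (unit_vec i) = coord_scale (f (unit_vec i) (s i)) (unit_vec (\<sigma> i))"
    if "i < n" for i
  proof
    fix l
    show "f (unit_vec i) l = coord_scale (f (unit_vec i) (s i)) (unit_vec (\<sigma> i)) l"
    proof (cases "l < n")
      case True
      then show ?thesis
        using support[OF that, of l] that by (auto simp: coord_scale_def unit_vec_def \<sigma>_def)
    next
      case False
      then show ?thesis
        using mem[OF that] s(1)[OF that] that
        by (auto simp: coord_space_def coord_scale_def unit_vec_def \<sigma>_def)
    qed
  qed
  ultimately show thesis using that[of \<sigma> "\<lambda>i. f (unit_vec i) (s i)"] s by blast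
qed

text \<open>
  Let \<open>f\<close> map \<open>e i\<close> to \<open>c i * e (\<sigma> i)\<close>. The coefficient of \<open>e (\<sigma> j)\<close> in the image of the square of
  \<open>e i\<close> is \<open>a i j * c j\<close> by linearity and \<open>(c i)\<^sup>2 * a (\<sigma> i) (\<sigma> j)\<close> by multiplicativity. For
  \<open>j = i\<close> both entries of \<open>a\<close> are 1, so \<open>c i = (c i)\<^sup>2\<close> and \<open>c i = 1\<close>.
\<close>
lemma Aut_permutes_unit_vecs:
  assumes "f \<in> carrier Aut"
  obtains \<sigma> where "\<sigma> \<in> matrix_symmetries n a"
    and "\<And>i. i < n \<Longrightarrow> f (unit_vec i) = unit_vec (\<sigma> i)"
proof -
  have f: "algebra_endo f" using assms by (simp add: Aut_iff)
  obtain \<sigma> c where \<sigma>: "\<sigma> permutes {..<n}"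
    and fe: "\<And>i. i < n \<Longrightarrow> f (unit_vec i) = coord_scale (c i) (unit_vec (\<sigma> i))"
    and c: "\<And>i. i < n \<Longrightarrow> c i \<noteq> 0"
    using Aut_monomial[OF assms] by blast
  have \<sigma>_less: "\<sigma> i < n" if "i < n" for i using permutes_in_image[OF \<sigma>, of i] that by simp
  have squares: "a i j * c j = c i * c i * a (\<sigma> i) (\<sigma> j)" if i: "i < n" and j: "j < n" for i j
  proof -
    have "f (a i) = f (evolution_mul n a (unit_vec i) (unit_vec i))"
      using i by (simp add: evolution_mul_unit_vec')
    also have "\<dots> = evolution_mul n a (f (unit_vec i)) (f (unit_vec i))"
      using i unit_vec_in_algebra by (simp only: endo_mul[OF f])
    also have "\<dots> = (\<lambda>l. c i * c i * a (\<sigma> i) l)"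
      using i by (simp add: fe evolution_mul_unit_vec \<sigma>_less)
    finally have "f (a i) (\<sigma> j) = c i * c i * a (\<sigma> i) (\<sigma> j)"
      by simp
    moreover have "f (a i) (\<sigma> j) = (\<Sum>l<n. if l = j then a i l * c l else 0)"
      unfolding algebra_endo_expansion[OF f row_in_coord_space[OF i]] sum_fun_apply
    proof (rule sum.cong)
      fix l assume "l \<in> {..<n}"
      then have "f (unit_vec l) = coord_scale (c l) (unit_vec (\<sigma> l))" using fe by simp
      moreover have "\<sigma> j = \<sigma> l \<longleftrightarrow> l = j" using permutes_inj[OF \<sigma>] by (auto dest: injD)
      ultimately show "coord_scale (a i l) (f (unit_vec l)) (\<sigma> j) =
          (if l = j then a i l * c l else 0)"
        by (simp add: coord_scale_def unit_vec_def)
    qed simp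
    ultimately show ?thesis using j by simp
  qed
  have c1: "c i = 1" if "i < n" for i
    using squares[OF that that] c[OF that] diagonal[OF that] diagonal[OF \<sigma>_less[OF that]] by simp
  show thesis
  proof
    show "\<sigma> \<in> matrix_symmetries n a"
      using \<sigma> squares by (simp add: matrix_symmetries_def c1)
    show "f (unit_vec i) = unit_vec (\<sigma> i)" if "i < n" for i
      using fe[OF that] c1[OF that] by simp
  qed
qed

definition perm_auto :: "(nat \<Rightarrow> nat) \<Rightarrow> (nat \<Rightarrow> 'k) \<Rightarrow> (nat \<Rightarrow> 'k)" where
  "perm_auto \<sigma> = (\<lambda>x\<in>coord_space n. x \<circ> inv_into UNIV \<sigma>)"

lemma perm_auto_unit_vec:
  assumes "\<sigma> permutes {..<n}" "i < n"
  shows "perm_auto \<sigma> (unit_vec i) = unit_vec (\<sigma> i)"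
  using assms unit_vec_in_algebra[OF assms(2)]
  by (auto simp: perm_auto_def unit_vec_def fun_eq_iff permutes_inverses[OF assms(1)])

lemma comp_perm_in_coord_space:
  assumes "\<sigma> permutes {..<n}" "x \<in> coord_space n"
  shows "x \<circ> \<sigma> \<in> coord_space n"
  using assms(2) permutes_not_in[OF assms(1)] by (auto simp: coord_space_def)

lemma perm_auto_in_Aut:
  assumes "\<sigma> \<in> matrix_symmetries n a"
  shows "perm_auto \<sigma> \<in> carrier Aut"
proof -
  have \<sigma>: "\<sigma> permutes {..<n}" and sym: "\<And>i j. i < n \<Longrightarrow> j < n \<Longrightarrow> a (\<sigma> i) (\<sigma> j) = a i j"
    using assms by (auto simp: matrix_symmetries_def)
  define \<tau> where "\<tau> = inv_into UNIV \<sigma>"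
  have \<tau>: "\<tau> permutes {..<n}" unfolding \<tau>_def by (rule permutes_inv[OF \<sigma>])
  have inverse: "\<sigma> (\<tau> i) = i" "\<tau> (\<sigma> i) = i" for i
    by (simp_all add: \<tau>_def permutes_inverses[OF \<sigma>])
  have perm_auto: "perm_auto \<sigma> = (\<lambda>x\<in>coord_space n. x \<circ> \<tau>)"
    by (simp add: perm_auto_def \<tau>_def)
  have "bij_betw (perm_auto \<sigma>) (coord_space n) (coord_space n)"
    by (rule bij_betw_byWitness[where f' = "\<lambda>x. x \<circ> \<sigma>"])
      (auto simp: perm_auto comp_perm_in_coord_space[OF \<sigma>] comp_perm_in_coord_space[OF \<tau>]
        fun_eq_iff inverse)
  then have bij: "perm_auto \<sigma> \<in> Bij (coord_space n)"
    by (simp add: Bij_def perm_auto)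
  have mul: "evolution_mul n a x y \<circ> \<tau> = evolution_mul n a (x \<circ> \<tau>) (y \<circ> \<tau>)" for x y
  proof
    fix j
    have row: "a i (\<tau> j) = a (\<sigma> i) j" if i: "i < n" for i
    proof (cases "j < n")
      case True
      then have "\<tau> j < n" using permutes_in_image[OF \<tau>, of j] by simp
      then show ?thesis using sym[OF i, of "\<tau> j"] by (simp add: inverse)
    next
      case False
      moreover have "\<sigma> i < n" using permutes_in_image[OF \<sigma>, of i] i by simp
      ultimately show ?thesis
        \<comment> \<open>For \<open>j \<ge> n\<close> both entries lie above the diagonal.\<close>
        using i above_diagonal[of i j] above_diagonal[of "\<sigma> i" j]
        by (simp add: permutes_not_in[OF \<tau>])
    qed
    have "(evolution_mul n a x y \<circ> \<tau>) j = (\<Sum>i<n. x i * y i * a (\<sigma> i) j)"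
      by (simp add: evolution_mul_def row)
    also have "\<dots> = (\<Sum>i<n. x (\<tau> i) * y (\<tau> i) * a i j)"
      by (subst sum.permute[OF \<sigma>, of "\<lambda>i. x (\<tau> i) * y (\<tau> i) * a i j"])
        (simp add: inverse)
    finally show "(evolution_mul n a x y \<circ> \<tau>) j =
        evolution_mul n a (x \<circ> \<tau>) (y \<circ> \<tau>) j"
      by (simp add: evolution_mul_def)
  qed
  have "algebra_endo (perm_auto \<sigma>)"
    unfolding algebra_endo_def
  proof (intro conjI ballI allI)
    show "perm_auto \<sigma> \<in> coord_space n \<rightarrow> coord_space n"
      by (auto simp: perm_auto comp_perm_in_coord_space[OF \<tau>])
    fix x y :: "nat \<Rightarrow> 'k" and c :: 'k
    assume x: "x \<in> coord_space n"
    then show "perm_auto \<sigma> (coord_scale c x) = coord_scale c (perm_auto \<sigma> x)"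
      using coord.subspace_scale[OF subspace_coord_space x]
      by (simp add: perm_auto coord_scale_def fun_eq_iff)
    assume y: "y \<in> coord_space n"
    show "perm_auto \<sigma> (x + y) = perm_auto \<sigma> x + perm_auto \<sigma> y"
      using x y coord.subspace_add[OF subspace_coord_space x y]
      by (simp add: perm_auto fun_eq_iff)
    show "perm_auto \<sigma> (evolution_mul n a x y) =
        evolution_mul n a (perm_auto \<sigma> x) (perm_auto \<sigma> y)"
      using x y mul_closed[OF x y] by (simp add: perm_auto mul)
  qed
  then show ?thesis using bij by (simp add: Aut_iff)
qed

lemma Aut_eqI:
  assumes "f \<in> carrier Aut" "g \<in> carrier Aut"
    and "\<And>i. i < n \<Longrightarrow> f (unit_vec i) = g (unit_vec i)"
  shows "f = g"
proof (rule extensionalityI)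
  show "f \<in> extensional (coord_space n)" "g \<in> extensional (coord_space n)"
    using assms by (auto simp: Aut_iff Bij_def)
  show "f x = g x" if "x \<in> coord_space n" for x
    using assms that by (simp add: Aut_iff algebra_endo_expansion)
qed

lemma bij_betw_perm_auto: "bij_betw perm_auto (matrix_symmetries n a) (carrier Aut)"
proof (rule bij_betw_imageI)
  show "inj_on perm_auto (matrix_symmetries n a)"
  proof (rule inj_onI)
    fix \<sigma> \<tau> assume "\<sigma> \<in> matrix_symmetries n a" "\<tau> \<in> matrix_symmetries n a"
      and eq: "perm_auto \<sigma> = perm_auto \<tau>"
    then have p: "\<sigma> permutes {..<n}" "\<tau> permutes {..<n}"
      by (auto simp: matrix_symmetries_def)
    show "\<sigma> = \<tau>"
    proof
      fix i
      show "\<sigma> i = \<tau> i"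
      proof (cases "i < n")
        case True
        then have "unit_vec (\<sigma> i) = (unit_vec (\<tau> i) :: nat \<Rightarrow> 'k)"
          using perm_auto_unit_vec[OF p(1)] perm_auto_unit_vec[OF p(2)] eq by metis
        then show ?thesis by (simp add: unit_vec_inject)
      next
        case False
        then show ?thesis using permutes_not_in[OF p(1), of i] permutes_not_in[OF p(2), of i] by simp
      qed
    qed
  qed
  have "f \<in> perm_auto ` matrix_symmetries n a" if f: "f \<in> carrier Aut" for f
  proof -
    obtain \<sigma> where \<sigma>: "\<sigma> \<in> matrix_symmetries n a"
      and fe: "\<And>i. i < n \<Longrightarrow> f (unit_vec i) = unit_vec (\<sigma> i)"
      using Aut_permutes_unit_vecs[OF f] by blast
    have "\<sigma> permutes {..<n}" using \<sigma> by (simp add: matrix_symmetries_def)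
    then have "f = perm_auto \<sigma>"
      using f perm_auto_in_Aut[OF \<sigma>] fe by (intro Aut_eqI) (simp_all add: perm_auto_unit_vec)
    then show ?thesis using \<sigma> by blast
  qed
  then show "perm_auto ` matrix_symmetries n a = carrier Aut"
    using perm_auto_in_Aut by blast
qed

lemma finite_Aut: "finite (carrier Aut)"
proof -
  have "finite (matrix_symmetries n a)"
    by (rule finite_subset[OF _ finite_permutations[of "{..<n}"]])
      (auto simp: matrix_symmetries_def)
  then show ?thesis using bij_betw_finite[OF bij_betw_perm_auto] by blast
qed

lemma order_Aut: "order Aut = card (matrix_symmetries n a)"
  using bij_betw_same_card[OF bij_betw_perm_auto] by (simp add: order_def)

end

section \<open>A matrix with symmetric group symmetry\<close>

definition staircase :: "nat \<Rightarrow> nat \<Rightarrow> nat \<Rightarrow> 'k::field" where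
  "staircase m i j = (if j = i \<or> m \<le> i \<and> j < i then 1 else 0)"

lemma lower_unitriangular_staircase: "lower_unitriangular n (staircase m)"
  by unfold_locales (auto simp: staircase_def)

text \<open>
  A symmetry preserves the number of nonzero entries of a row, which is 1 in the first \<open>m\<close> rows and
  \<open>i + 1\<close> in row \<open>i \<ge> m\<close>. As \<open>m\<close> is positive, \<open>i + 1\<close> differs from 1, so that the indices
  \<open>i \<ge> m\<close> are fixed.
\<close>
lemma matrix_symmetries_staircase:
  assumes m: "0 < m" "m \<le> n"
  shows "matrix_symmetries n (staircase m :: nat \<Rightarrow> nat \<Rightarrow> 'k::field) = {\<sigma>. \<sigma> permutes {..<m}}"
proof (intro equalityI subsetI)
  let ?a = "staircase m :: nat \<Rightarrow> nat \<Rightarrow> 'k"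
  fix \<sigma> assume "\<sigma> \<in> matrix_symmetries n ?a"
  then have \<sigma>: "\<sigma> permutes {..<n}" and sym: "\<And>i j. i < n \<Longrightarrow> j < n \<Longrightarrow> ?a (\<sigma> i) (\<sigma> j) = ?a i j"
    by (auto simp: matrix_symmetries_def)
  have row: "card {j. j < n \<and> ?a i j \<noteq> 0} = (if i < m then 1 else Suc i)" if "i < n" for i
  proof -
    have "{j. j < n \<and> ?a i j \<noteq> 0} = (if i < m then {i} else {..i})"
      using that by (auto simp: staircase_def split: if_splits)
    then show ?thesis by simp
  qed
  have fixed: "\<sigma> i = i" if i: "m \<le> i" "i < n" for i
  proof -
    have "\<sigma> i < n" using permutes_in_image[OF \<sigma>, of i] i by simp
    have "bij_betw \<sigma> {j. j < n \<and> ?a i j \<noteq> 0} {j. j < n \<and> ?a (\<sigma> i) j \<noteq> 0}"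
    proof (rule bij_betw_imageI)
      show "inj_on \<sigma> {j. j < n \<and> ?a i j \<noteq> 0}"
        using permutes_inj[OF \<sigma>] by (rule inj_on_subset) simp
      show "\<sigma> ` {j. j < n \<and> ?a i j \<noteq> 0} = {j. j < n \<and> ?a (\<sigma> i) j \<noteq> 0}"
      proof (intro equalityI subsetI)
        fix l assume "l \<in> \<sigma> ` {j. j < n \<and> ?a i j \<noteq> 0}"
        then obtain j where "j < n" "?a i j \<noteq> 0" "l = \<sigma> j" by blast
        then show "l \<in> {j. j < n \<and> ?a (\<sigma> i) j \<noteq> 0}"
          using sym[OF i(2), of j] permutes_in_image[OF \<sigma>, of j] by simp
      next
        fix l assume l: "l \<in> {j. j < n \<and> ?a (\<sigma> i) j \<noteq> 0}"
        then have "l \<in> \<sigma> ` {..<n}" using permutes_image[OF \<sigma>] by simp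
        then obtain j where "j < n" "l = \<sigma> j" by blast
        then show "l \<in> \<sigma> ` {j. j < n \<and> ?a i j \<noteq> 0}"
          using sym[OF i(2), of j] l by simp
      qed
    qed
    then have "card {j. j < n \<and> ?a i j \<noteq> 0} = card {j. j < n \<and> ?a (\<sigma> i) j \<noteq> 0}"
      by (rule bij_betw_same_card)
    then have "(if i < m then 1 else Suc i) = (if \<sigma> i < m then 1 else Suc (\<sigma> i))"
      unfolding row[OF i(2)] row[OF \<open>\<sigma> i < n\<close>] .
    then show ?thesis using i m by (simp split: if_splits)
  qed
  have "\<sigma> permutes {..<m}"
    by (rule permutes_superset[OF \<sigma>]) (use fixed in auto)
  then show "\<sigma> \<in> {\<sigma>. \<sigma> permutes {..<m}}" by simp
next
  let ?a = "staircase m :: nat \<Rightarrow> nat \<Rightarrow> 'k"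
  fix \<sigma> assume "\<sigma> \<in> {\<sigma>. \<sigma> permutes {..<m}}"
  then have \<sigma>: "\<sigma> permutes {..<m}" by simp
  have "\<sigma> permutes {..<n}" using permutes_subset[OF \<sigma>] m by auto
  moreover have "?a (\<sigma> i) (\<sigma> j) = ?a i j" for i j
  proof -
    have eq: "\<sigma> j = \<sigma> i \<longleftrightarrow> j = i" using permutes_inj[OF \<sigma>] by (auto dest: injD)
    have lt: "\<sigma> l < m \<longleftrightarrow> l < m" for l using permutes_in_image[OF \<sigma>, of l] by simp
    show ?thesis
    proof (cases "i < m")
      case True
      then show ?thesis using eq lt[of i] by (simp add: staircase_def)
    next
      case False
      then have i: "\<sigma> i = i" using permutes_not_in[OF \<sigma>] by simp
      have "\<sigma> j < i \<longleftrightarrow> j < i"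
        using False lt[of j] permutes_not_in[OF \<sigma>, of j] by (cases "j < m") auto
      then show ?thesis using eq i by (simp add: staircase_def)
    qed
  qed
  ultimately show "\<sigma> \<in> matrix_symmetries n ?a" by (simp add: matrix_symmetries_def)
qed

text \<open>
  If \<open>p = m - 1\<close> is the numerator of \<open>r\<close>, then \<open>p\<close> divides \<open>m!\<close> and the quotient is still a
  multiple of \<open>m\<close>. Hence \<open>n\<close>, which is the denominator times this quotient, is at least \<open>m\<close>.
\<close>
lemma rat_eq_fact_ratio:
  fixes r :: rat
  assumes "0 < r"
  obtains m n where "0 < m" "m \<le> n" "r = of_nat (fact m) / of_nat n"
proof -
  obtain u v :: int where uv: "r = Fract u v" "0 < v"
    by (cases r) auto
  then have "0 < u" using assms by (simp add: zero_less_Fract_iff)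
  define p q where "p = nat u - 1" and "q = nat v"
  have r: "r = of_nat (Suc p) / of_nat q" and "0 < q"
    using uv \<open>0 < u\<close> by (simp_all add: p_def q_def Fract_of_int_quotient)
  \<comment> \<open>The numerator of \<open>r\<close> is \<open>p + 1\<close> here, so \<open>m = p + 2\<close> and \<open>n = q (p + 2) p!\<close>.\<close>
  show thesis
  proof
    show "0 < Suc (Suc p)" by simp
    have "Suc (Suc p) * 1 \<le> Suc (Suc p) * (q * fact p)"
      using \<open>0 < q\<close> by (intro mult_le_mono2) (simp add: Suc_le_eq)
    then show "Suc (Suc p) \<le> Suc (Suc p) * (q * fact p)" by simp
    have "of_nat (fact (Suc (Suc p))) = (of_nat (Suc (Suc p)) * (of_nat (Suc p) * fact p) :: rat)"
      by (simp add: algebra_simps)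
    then show "r = of_nat (fact (Suc (Suc p))) / of_nat (Suc (Suc p) * (q * fact p))"
      using \<open>0 < q\<close> unfolding r of_nat_mult
      by (simp del: of_nat_Suc fact_Suc)
  qed
qed

theorem theorem1p6:
  fixes r :: rat
  assumes "0 < r"
  shows "\<exists>(scale :: 'k::field \<Rightarrow> (nat \<Rightarrow> 'k) \<Rightarrow> (nat \<Rightarrow> 'k)) A mul.
    regular_evolution_algebra scale A mul \<and>
    nonassoc_algebra.fin_dim scale A \<and>
    finite (carrier (nonassoc_algebra.Aut scale A mul)) \<and>
    r = of_nat (order (nonassoc_algebra.Aut scale A mul)) / of_nat (vector_space.dim scale A)"
proof -
  obtain m n where m: "0 < m" "m \<le> n" and r: "r = of_nat (fact m) / of_nat n"
    using rat_eq_fact_ratio[OF assms] .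
  interpret lower_unitriangular n "staircase m :: nat \<Rightarrow> nat \<Rightarrow> 'k"
    by (rule lower_unitriangular_staircase)
  have "order Aut = fact m"
    using m by (simp add: order_Aut matrix_symmetries_staircase card_permutations[OF card_lessThan])
  then have "r = of_nat (order Aut) / of_nat (coord.dim (coord_space n :: (nat \<Rightarrow> 'k) set))"
    by (simp only: r dim_coord_space)
  then show ?thesis
    using regular_evolution_algebra_axioms fin_dim finite_Aut by blast
qed

end
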